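(* Let $p_0$ be the density of a simple hypothesis and $p_1,\dots,p_s$ the densities of $s$ alternatives for an observation $X$. Suppose there exists a group $G$ of transformations of the sample which leaves invariant both $p_0$ and the set $\{p_1,\dots,p_s\}$ (i.e. each transformation in $G$ results in a permutation of $p_1,\dots,p_s$). Let $\bar G$ denote the set of these permutations and suppose that it is transitive over the set $\{p_1,\dots,p_s\}$, i.e. that given any $i$ and $j$ there exists a transformation in $\bar G$ taking $p_i$ into $p_j$. Then, for testing $p_0$ against the alternatives $p_1,\dots,p_s$, there exists a uniformly most powerful invariant test, and it rejects when $$\frac{\sum_{i=1}^s p_i(x)/s}{p_0(x)}\quad\text{is sufficiently large.}$$
   Context: That $g\in G$ leaves $p_0$ invariant means that if $X$ has density $p_0$ then so does $g(X)$; that $g$ leaves the set $\{p_1,\dots,p_s\}$ invariant means that there is a permutation $\bar g$ of $p_1,\dots,p_s$ such that if $X$ has density $p_i$ then $g(X)$ has density $\bar g(p_i)$. A test is given by a rejection region $R$ in the sample space and rejects the hypothesis when $X\in R$. A rejection region $R$ (and its test) is invariant if $x\in R$ if and only if $g(x)\in R$ for all $g$ in $G$. A uniformly most powerful invariant test is one that, among all invariant tests at the given level, maximizes the power against each of $p_1,\dots,p_s$, the power against $p_i$ being the probability of $R$ under $p_i$.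
   Formalization: Each ratio test, at its attained level, is shown UMP among almost invariant tests; it is UMP invariant up to null sets if it has an invariant version, proved for countable G, and exactly so if the densities transform pointwise. For general uncountable G the literal claim can fail. *)

theory Defs
  imports "HOL-Probability.Probability" "HOL-Algebra.Bij"
begin

text \<open>
  The sample space is \<open>space M\<close>, and all densities are taken with respect to \<open>M\<close>.
  A family \<open>p\<close> lists the hypothesis \<open>p 0\<close> and the alternatives \<open>p 1, \<dots>, p s\<close>.
\<close>

abbreviation law :: "'a measure \<Rightarrow> (nat \<Rightarrow> 'a \<Rightarrow> ennreal) \<Rightarrow> nat \<Rightarrow> 'a measure" where
  "law M p i \<equiv> density M (p i)"

text \<open>
  The elements of \<^const>\<open>BijGroup\<close> are bijections of \<open>space M\<close>, extended by \<open>undefined\<close>;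
  measurability of inverses follows from closure under inverses.
\<close>

definition transformation_group :: "'a measure \<Rightarrow> ('a \<Rightarrow> 'a) set \<Rightarrow> bool" where
  "transformation_group M G \<longleftrightarrow> subgroup G (BijGroup (space M)) \<and> G \<subseteq> measurable M M"

text \<open>
  If \<open>X\<close> has density \<open>f\<close> then \<open>g(X)\<close> has density \<open>h\<close>. This depends only on the law of \<open>X\<close>,
  so \<open>X\<close> is taken to be the identity on the sample space.
\<close>

definition carries_density ::
    "'a measure \<Rightarrow> ('a \<Rightarrow> 'a) \<Rightarrow> ('a \<Rightarrow> ennreal) \<Rightarrow> ('a \<Rightarrow> ennreal) \<Rightarrow> bool" where
  "carries_density M g f h \<longleftrightarrow> distributed (density M f) M g h"

text \<open>
  The permutations act on the indices of the alternatives, so that alternatives listed more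
  than once are counted with multiplicity, as they are in the sum of the densities.
\<close>

definition induces_permutation ::
    "'a measure \<Rightarrow> (nat \<Rightarrow> 'a \<Rightarrow> ennreal) \<Rightarrow> nat \<Rightarrow> ('a \<Rightarrow> 'a) \<Rightarrow> (nat \<Rightarrow> nat) \<Rightarrow> bool" where
  "induces_permutation M p s g \<pi> \<longleftrightarrow>
     \<pi> permutes {1..s} \<and> (\<forall>i\<in>{1..s}. carries_density M g (p i) (p (\<pi> i)))"

definition induced_permutations ::
    "'a measure \<Rightarrow> (nat \<Rightarrow> 'a \<Rightarrow> ennreal) \<Rightarrow> nat \<Rightarrow> ('a \<Rightarrow> 'a) set \<Rightarrow> (nat \<Rightarrow> nat) set" where
  "induced_permutations M p s G = {\<pi>. \<exists>g\<in>G. induces_permutation M p s g \<pi>}"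

definition invariant_tests :: "'a measure \<Rightarrow> ('a \<Rightarrow> 'a) set \<Rightarrow> 'a set set" where
  "invariant_tests M G = {R \<in> sets M. \<forall>g\<in>G. \<forall>x\<in>space M. x \<in> R \<longleftrightarrow> g x \<in> R}"

text \<open>
  Densities are determined only almost everywhere, and hence so are the regions defined
  through them. Two regions are identified when they differ by a null set under the
  hypothesis and under each alternative.
\<close>

definition equivalent_tests ::
    "'a measure \<Rightarrow> (nat \<Rightarrow> 'a \<Rightarrow> ennreal) \<Rightarrow> nat \<Rightarrow> 'a set \<Rightarrow> 'a set \<Rightarrow> bool" where
  "equivalent_tests M p s R R' \<longleftrightarrow> (\<forall>i\<le>s. AE x in law M p i. x \<in> R \<longleftrightarrow> x \<in> R')"

definition almost_invariant_tests ::
    "'a measure \<Rightarrow> (nat \<Rightarrow> 'a \<Rightarrow> ennreal) \<Rightarrow> nat \<Rightarrow> ('a \<Rightarrow> 'a) set \<Rightarrow> 'a set set" where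
  "almost_invariant_tests M p s G =
     {R \<in> sets M. \<forall>g\<in>G. \<forall>i\<le>s. AE x in law M p i. x \<in> R \<longleftrightarrow> g x \<in> R}"

definition UMP_among ::
    "'a set set \<Rightarrow> 'a measure \<Rightarrow> (nat \<Rightarrow> 'a \<Rightarrow> ennreal) \<Rightarrow> nat \<Rightarrow> real \<Rightarrow> 'a set \<Rightarrow> bool" where
  "UMP_among \<T> M p s \<alpha> R \<longleftrightarrow>
     R \<in> \<T> \<and> measure (law M p 0) R \<le> \<alpha> \<and>
     (\<forall>S\<in>\<T>. measure (law M p 0) S \<le> \<alpha> \<longrightarrow>
        (\<forall>i\<in>{1..s}. measure (law M p i) S \<le> measure (law M p i) R))"

abbreviation UMP_invariant ::
    "'a measure \<Rightarrow> ('a \<Rightarrow> 'a) set \<Rightarrow> (nat \<Rightarrow> 'a \<Rightarrow> ennreal) \<Rightarrow> nat \<Rightarrow> real \<Rightarrow> 'a set \<Rightarrow> bool" where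
  "UMP_invariant M G \<equiv> UMP_among (invariant_tests M G) M"

text \<open>
  The quotient is infinite where only the denominator vanishes. Where both terms vanish it is
  0, which is immaterial: such points are null under the hypothesis and all alternatives.
\<close>

definition average_ratio :: "(nat \<Rightarrow> 'a \<Rightarrow> ennreal) \<Rightarrow> nat \<Rightarrow> 'a \<Rightarrow> ennreal" where
  "average_ratio p s x = (\<Sum>i=1..s. p i x / of_nat s) / p 0 x"

text \<open>
  The tests that reject when the ratio is sufficiently large. The threshold \<open>\<infinity>\<close> with a weak
  inequality gives the largest of these regions that is null under the hypothesis; with a
  strict inequality it would give the empty region, which is excluded because it need not be
  most powerful at level 0.
\<close>

definition ratio_tests :: "'a measure \<Rightarrow> (nat \<Rightarrow> 'a \<Rightarrow> ennreal) \<Rightarrow> nat \<Rightarrow> 'a set set" where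
  "ratio_tests M p s =
     {{x \<in> space M. k \<le> average_ratio p s x} | k. True} \<union>
     {{x \<in> space M. k < average_ratio p s x} | k. k < \<infinity>}"

text \<open>
  The transformation formula for densities, holding at every point instead of almost
  everywhere, with \<open>J\<close> in the role of the Jacobian of \<open>g\<close>: if \<open>X\<close> has density \<open>f\<close>, the density
  \<open>h\<close> of \<open>g(X)\<close> satisfies \<open>h (g x) * J x = f x\<close>.
\<close>

definition pointwise_transformation ::
    "'a measure \<Rightarrow> (nat \<Rightarrow> 'a \<Rightarrow> ennreal) \<Rightarrow> nat \<Rightarrow> ('a \<Rightarrow> 'a) \<Rightarrow> bool" where
  "pointwise_transformation M p s g \<longleftrightarrow>
     (\<exists>J \<pi>. \<pi> permutes {1..s} \<and>
        (\<forall>x\<in>space M. 0 < J x \<and> J x < \<infinity> \<and> p 0 (g x) * J x = p 0 x \<and>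
           (\<forall>i\<in>{1..s}. p (\<pi> i) (g x) * J x = p i x)))"

end

theory Submission
  imports Defs
begin

text \<open>
  Write \<open>q\<close> for the average of the alternatives. By transitivity an (almost) invariant region has
  the same probability under every alternative, hence under \<open>q\<close>, so the Neyman-Pearson lemma
  for \<open>p 0\<close> against \<open>q\<close> applies. The group preserves both laws, so by uniqueness of densities
  the quotients \<open>p 0 / (p 0 + q)\<close> and \<open>q / (p 0 + q)\<close>, and with them the likelihood ratio, are
  almost everywhere invariant.
\<close>

section \<open>Quotients, uniqueness of densities and the Neyman-Pearson lemma\<close>

lemma ennreal_divide_bound:
  fixes f r k :: ennreal
  assumes "f < \<infinity>" "r < \<infinity>" "k < \<infinity>"
  shows "k \<le> r / f \<Longrightarrow> k * f \<le> r" "r / f \<le> k \<Longrightarrow> r \<le> k * f"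
proof -
  have *: "r / f * f = r" if "f \<noteq> 0"
    using that assms by (simp add: ennreal_divide_times ennreal_times_divide ennreal_mult_divide_eq)
  show "k * f \<le> r" if "k \<le> r / f"
    using mult_right_mono[OF that, of f] * by (cases "f = 0") auto
  \<comment> \<open>When \<open>f = 0\<close>, a finite \<open>k\<close> excludes the value
    \<open>r / 0 = \<infinity>\<close>, which leaves \<open>r = 0\<close>.\<close>
  show "r \<le> k * f" if "r / f \<le> k"
    using mult_right_mono[OF that, of f] * that assms
    by (cases "f = 0") (auto simp: top_unique split: if_splits)
qed

lemma distr_density_eqI:
  assumes "g \<in> measurable M M"
    and "\<And>A. A \<in> sets M \<Longrightarrow> emeasure (density M f) (g -` A \<inter> space M) = emeasure (density M f) A"
  shows "distr (density M f) M g = density M f"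
  by (rule measure_eqI) (use assms in \<open>auto simp: emeasure_distr\<close>)

text \<open>Substitution along \<open>g\<close>, which preserves \<open>N\<close>, turns the
  integral of \<open>f (g x)\<close> over \<open>A\<close> into that of \<open>f\<close> over the
  preimage of \<open>A\<close> under \<open>h\<close>, and \<open>h\<close> preserves
  \<open>density N f\<close>. So both functions are densities of one measure over the finite
  \<open>N\<close>, hence agree almost everywhere.\<close>

lemma AE_density_invariant:
  fixes f :: "'a \<Rightarrow> ennreal"
  assumes "finite_measure N" and f[measurable]: "f \<in> borel_measurable N"
    and g[measurable]: "g \<in> measurable N N" and h[measurable]: "h \<in> measurable N N"
    and hg: "\<And>x. x \<in> space N \<Longrightarrow> h (g x) = x"
    and dg: "distr N N g = N" and dh: "distr (density N f) N h = density N f"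
  shows "AE x in N. f (g x) = f x"
proof -
  interpret finite_measure N by fact
  have "density N (\<lambda>x. f (g x)) = density N f"
  proof (rule measure_eqI)
    fix A assume "A \<in> sets (density N (\<lambda>x. f (g x)))"
    then have A[measurable]: "A \<in> sets N" by simp
    \<comment> \<open>Evaluating the indicator at \<open>h (g x) = x\<close> makes the whole
      integrand a function of \<open>g x\<close>.\<close>
    have "emeasure (density N (\<lambda>x. f (g x))) A = (\<integral>\<^sup>+x. f (g x) * indicator A (h (g x)) \<partial>N)"
      by (simp add: emeasure_density hg cong: nn_integral_cong)
    also have "\<dots> = (\<integral>\<^sup>+y. f y * indicator A (h y) \<partial>distr N N g)"
      by (simp add: nn_integral_distr)
    also have "\<dots> = (\<integral>\<^sup>+y. f y * indicator (h -` A \<inter> space N) y \<partial>N)"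
      unfolding dg by (intro nn_integral_cong) (simp split: split_indicator)
    also have "\<dots> = emeasure (distr (density N f) N h) A"
      by (simp add: emeasure_distr emeasure_density)
    finally show "emeasure (density N (\<lambda>x. f (g x))) A = emeasure (density N f) A"
      unfolding dh .
  qed simp
  then show ?thesis
    by (rule density_unique[rotated 2]) measurable
qed

text \<open>The product of \<open>q - k f\<close> with the difference of the indicators of
  \<open>R\<close> and \<open>S\<close> is nonnegative; integrate. The terms are arranged as sums
  because subtraction truncates in \<open>ennreal\<close>. Points with \<open>q x = k * f x\<close>
  may lie on either side, which covers weak and strict thresholds alike.\<close>

lemma Neyman_Pearson:
  fixes f q :: "'a \<Rightarrow> ennreal" and k :: ennreal
  assumes f[measurable]: "f \<in> borel_measurable M" and q[measurable]: "q \<in> borel_measurable M"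
    and "finite_measure (density M f)" and "finite_measure (density M q)"
    and R[measurable]: "R \<in> sets M" and S[measurable]: "S \<in> sets M"
    and k: "k < \<infinity>"
    and ge: "AE x in M. x \<in> R \<longrightarrow> k * f x \<le> q x"
    and le: "AE x in M. x \<notin> R \<longrightarrow> q x \<le> k * f x"
    and level: "measure (density M f) S \<le> measure (density M f) R"
  shows "measure (density M q) S \<le> measure (density M q) R"
proof -
  interpret f: finite_measure "density M f" by fact
  interpret q: finite_measure "density M q" by fact
  let ?F = "emeasure (density M f)" and ?Q = "emeasure (density M q)"
  have "?Q S + k * ?F R = (\<integral>\<^sup>+x. q x * indicator S x + k * (f x * indicator R x) \<partial>M)"
    by (simp add: emeasure_density nn_integral_add nn_integral_cmult)
  also have "\<dots> \<le> (\<integral>\<^sup>+x. q x * indicator R x + k * (f x * indicator S x) \<partial>M)"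
    using ge le by (intro nn_integral_mono_AE, eventually_elim)
      (auto split: split_indicator simp: add.commute)
  also have "\<dots> = ?Q R + k * ?F S"
    by (simp add: emeasure_density nn_integral_add nn_integral_cmult)
  also have "\<dots> \<le> ?Q R + k * ?F R"
    using level by (intro add_left_mono mult_left_mono) (auto simp: f.emeasure_eq_measure)
  \<comment> \<open>The common term cancels because \<open>k\<close> and the mass of
    \<open>R\<close> are both finite.\<close>
  finally have "?Q S \<le> ?Q R"
    using k f.emeasure_finite[of R]
    by (auto simp: add.commute ennreal_add_left_cancel_le ennreal_mult_eq_top_iff)
  then show ?thesis
    by (simp add: q.emeasure_eq_measure)
qed

section \<open>The testing problem and the average of the alternatives\<close>

locale transitive_testing_problem =
  fixes M :: "'a measure" and p :: "nat \<Rightarrow> 'a \<Rightarrow> ennreal" and s :: nat and G :: "('a \<Rightarrow> 'a) set"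
  assumes s: "1 \<le> s"
    and measurable_p: "\<And>i. i \<le> s \<Longrightarrow> p i \<in> borel_measurable M"
    and prob_law: "\<And>i. i \<le> s \<Longrightarrow> prob_space (law M p i)"
    and group: "transformation_group M G"
    and carries0: "\<And>g. g \<in> G \<Longrightarrow> carries_density M g (p 0) (p 0)"
    and induces: "\<And>g. g \<in> G \<Longrightarrow> \<exists>\<pi>. induces_permutation M p s g \<pi>"
    and transitive: "\<And>i j. i \<in> {1..s} \<Longrightarrow> j \<in> {1..s} \<Longrightarrow>
      \<exists>\<pi>\<in>induced_permutations M p s G. \<pi> i = j"
begin

definition q :: "'a \<Rightarrow> ennreal" where
  "q x = (\<Sum>i=1..s. p i x / of_nat s)"

lemma average_ratio_eq: "average_ratio p s x = q x / p 0 x"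
  by (simp add: average_ratio_def q_def)

lemma measurable_p0[measurable]: "p 0 \<in> borel_measurable M"
  by (simp add: measurable_p)

lemma measurable_q[measurable]: "q \<in> borel_measurable M"
  unfolding q_def using measurable_p
  by (intro borel_measurable_sum borel_measurable_divide) auto

lemma measurable_average_ratio[measurable]: "average_ratio p s \<in> borel_measurable M"
  unfolding average_ratio_eq by measurable

lemma emeasure_q:
  assumes [measurable]: "A \<in> sets M"
  shows "emeasure (density M q) A = (\<Sum>i=1..s. emeasure (law M p i) A / of_nat s)"
proof -
  have "emeasure (density M q) A =
      (\<integral>\<^sup>+x. (\<Sum>i=1..s. p i x * indicator A x / of_nat s) \<partial>M)"
    by (simp add: emeasure_density q_def sum_distrib_left sum_distrib_right divide_ennreal_def mult_ac)
  also have "\<dots> = (\<Sum>i=1..s. \<integral>\<^sup>+x. p i x * indicator A x / of_nat s \<partial>M)"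
    using measurable_p by (intro nn_integral_sum) auto
  also have "\<dots> = (\<Sum>i=1..s. emeasure (law M p i) A / of_nat s)"
    using measurable_p by (intro sum.cong) (auto simp: nn_integral_divide emeasure_density)
  finally show ?thesis .
qed

text \<open>Here \<open>1 \<le> s\<close> enters: the mean of \<open>s\<close> equal values is that
  value. This yields both the total mass 1 of \<open>density M q\<close> and the power of an almost
  invariant region.\<close>

lemma emeasure_q_eq:
  assumes "A \<in> sets M" and c: "\<And>i. i \<in> {1..s} \<Longrightarrow> emeasure (law M p i) A = c"
  shows "emeasure (density M q) A = c"
proof -
  have "emeasure (density M q) A = of_nat s * (c / of_nat s)"
    using assms by (simp add: emeasure_q)
  also have "\<dots> = c"
    using s by (simp add: ennreal_times_divide ennreal_mult_divide_eq mult.commute[of _ c])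
  finally show ?thesis .
qed

lemma prob_q: "prob_space (density M q)"
proof
  have "emeasure (law M p i) (space M) = 1" if "i \<in> {1..s}" for i
    using prob_space.emeasure_space_1[OF prob_law, of i] that by simp
  then show "emeasure (density M q) (space (density M q)) = 1"
    using emeasure_q_eq[of "space M" 1] by simp
qed

section \<open>The group and its action on the laws\<close>

lemma G_measurable: "g \<in> G \<Longrightarrow> g \<in> measurable M M"
  using group by (auto simp: transformation_group_def)

lemma G_space: "g \<in> G \<Longrightarrow> x \<in> space M \<Longrightarrow> g x \<in> space M"
  using measurable_space[OF G_measurable] .

lemma G_Bij: "g \<in> G \<Longrightarrow> g \<in> Bij (space M)"
  using group subgroup.subset[of G "BijGroup (space M)"]
  by (auto simp: transformation_group_def BijGroup_def)

lemma G_id: "\<exists>e\<in>G. \<forall>x\<in>space M. e x = x"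
  using group subgroup.one_closed[of G "BijGroup (space M)"]
  by (intro bexI[of _ "\<lambda>x\<in>space M. x"]) (auto simp: transformation_group_def BijGroup_def)

lemma G_compose:
  assumes "g \<in> G" "h \<in> G"
  shows "\<exists>k\<in>G. \<forall>x\<in>space M. k x = h (g x)"
proof
  show "compose (space M) h g \<in> G"
    using subgroup.m_closed[of G "BijGroup (space M)" h g] group assms G_Bij
    by (simp add: transformation_group_def BijGroup_def)
qed (simp add: compose_def)

lemma G_inverse:
  assumes g: "g \<in> G"
  shows "\<exists>h\<in>G. \<forall>x\<in>space M. h (g x) = x"
proof
  let ?h = "inv\<^bsub>BijGroup (space M)\<^esub> g"
  show h: "?h \<in> G"
    using group g by (simp add: transformation_group_def subgroup.m_inv_closed)
  have "?h \<otimes>\<^bsub>BijGroup (space M)\<^esub> g = \<one>\<^bsub>BijGroup (space M)\<^esub>"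
    using G_Bij[OF g] by (intro group.l_inv group_BijGroup) (simp add: BijGroup_def)
  then have "compose (space M) ?h g = (\<lambda>x\<in>space M. x)"
    using G_Bij[OF g] G_Bij[OF h] by (simp add: BijGroup_def)
  then show "\<forall>x\<in>space M. ?h (g x) = x"
    by (metis compose_eq restrict_apply')
qed

lemma carries_emeasure:
  assumes "carries_density M g f f'" and "A \<in> sets M"
  shows "emeasure (density M f') A = emeasure (density M f) (g -` A \<inter> space M)"
proof -
  have "distr (density M f) M g = density M f'" "g \<in> measurable (density M f) M"
    using assms by (auto simp: carries_density_def distributed_def)
  then show ?thesis
    using emeasure_distr[of g "density M f" M A] assms(2) by simp
qed

lemma emeasure_p0_vimage:
  assumes "g \<in> G" "A \<in> sets M"
  shows "emeasure (law M p 0) (g -` A \<inter> space M) = emeasure (law M p 0) A"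
  using carries_emeasure[OF carries0] assms by simp

text \<open>The transformation only permutes the alternatives, and reordering the summands leaves
  their average unchanged.\<close>

lemma emeasure_q_vimage:
  assumes g: "g \<in> G" and A: "A \<in> sets M"
  shows "emeasure (density M q) (g -` A \<inter> space M) = emeasure (density M q) A"
proof -
  obtain \<pi> where \<pi>: "\<pi> permutes {1..s}"
    and c: "\<And>i. i \<in> {1..s} \<Longrightarrow> carries_density M g (p i) (p (\<pi> i))"
    using induces[OF g] by (auto simp: induces_permutation_def)
  have "emeasure (density M q) (g -` A \<inter> space M) =
      (\<Sum>i=1..s. emeasure (law M p (\<pi> i)) A / of_nat s)"
    using carries_emeasure[OF c A] measurable_sets[OF G_measurable[OF g] A]
    by (simp add: emeasure_q)
  also have "\<dots> = (\<Sum>i=1..s. emeasure (law M p i) A / of_nat s)"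
    using sum.permute[OF \<pi>, of "\<lambda>i. emeasure (law M p i) A / of_nat s"] by (simp add: o_def)
  finally show ?thesis
    using A by (simp add: emeasure_q)
qed

section \<open>Almost everywhere invariance of the likelihood ratio\<close>

text \<open>\<open>density M u\<close> serves as reference measure in place of \<open>M\<close>: it
  is finite and preserved by the group, neither of which is assumed of \<open>M\<close>, and it
  dominates all the laws.\<close>

definition u :: "'a \<Rightarrow> ennreal" where
  "u x = p 0 x + q x"

lemma measurable_u[measurable]: "u \<in> borel_measurable M"
  unfolding u_def[abs_def] by measurable

lemma emeasure_u:
  "A \<in> sets M \<Longrightarrow>
    emeasure (density M u) A = emeasure (law M p 0) A + emeasure (density M q) A"
  unfolding u_def[abs_def] by (simp add: emeasure_density_add)

lemma finite_u: "finite_measure (density M u)"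
proof
  show "emeasure (density M u) (space (density M u)) \<noteq> \<infinity>"
    using prob_space.emeasure_space_1[OF prob_law[of 0]] prob_space.emeasure_space_1[OF prob_q]
    by (simp add: emeasure_u)
qed

lemma AE_u_finite: "AE x in M. u x < \<infinity>"
proof -
  have "integral\<^sup>N M u = emeasure (density M u) (space M)"
    by (simp add: emeasure_density cong: nn_integral_cong)
  then have "integral\<^sup>N M u \<noteq> \<infinity>"
    using finite_measure.emeasure_finite[OF finite_u, of "space M"] by simp
  then show ?thesis
    using nn_integral_PInf_AE[of u M] by (simp add: less_top)
qed

lemma AE_u_bounds: "AE x in density M u. 0 < u x \<and> u x < \<infinity>"
  using AE_u_finite by (auto simp: AE_density)

text \<open>Where \<open>u\<close> vanishes so does \<open>f\<close>, by the bound, so the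
  convention \<open>0 / 0 = 0\<close> does no harm; infinite values of \<open>u\<close> are excluded
  almost everywhere.\<close>

lemma density_u_divide:
  assumes [measurable]: "f \<in> borel_measurable M" and "\<And>x. f x \<le> u x"
  shows "density (density M u) (\<lambda>x. f x / u x) = density M f"
proof -
  have "u x * (f x / u x) = f x" if "u x < \<infinity>" for x
    using that assms(2)[of x]
    by (cases "u x = 0") (auto simp: ennreal_times_divide mult.commute ennreal_mult_divide_eq)
  then show ?thesis
    using AE_u_finite by (subst density_density_eq) (auto intro!: density_cong)
qed

text \<open>Apply \<open>AE_density_invariant\<close> over \<open>density M u\<close>, with
  \<open>f / u\<close> as the density of \<open>density M f\<close>. Invariance is assumed for the
  whole group because the inverse of \<open>g\<close> is used too. The cases of interest are
  \<open>p 0\<close> and \<open>q\<close>.\<close>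

lemma AE_quotient_invariant:
  assumes g: "g \<in> G" and [measurable]: "f \<in> borel_measurable M" and le: "\<And>x. f x \<le> u x"
    and inv: "\<And>h A. h \<in> G \<Longrightarrow> A \<in> sets M \<Longrightarrow>
      emeasure (density M f) (h -` A \<inter> space M) = emeasure (density M f) A"
  shows "AE x in density M u. f (g x) / u (g x) = f x / u x"
proof -
  obtain h where h: "h \<in> G" "\<And>x. x \<in> space M \<Longrightarrow> h (g x) = x"
    using G_inverse[OF g] by auto
  note [measurable] = G_measurable[OF g] G_measurable[OF h(1)]
  have u_inv: "distr (density M u) M g = density M u"
    by (rule distr_density_eqI) (auto simp: emeasure_u emeasure_p0_vimage emeasure_q_vimage g)
  have f_inv: "distr (density M f) M h = density M f"
    by (rule distr_density_eqI) (auto simp: inv h)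
  \<comment> \<open>\<open>distr\<close> depends on its target only through the sigma-algebra, which
    \<open>M\<close> and \<open>density M u\<close> share.\<close>
  have cong: "distr N (density M u) k = distr N M k" for N :: "'a measure" and k
    by (intro distr_cong) auto
  show ?thesis
    by (rule AE_density_invariant[of _ _ _ h])
      (auto simp: finite_u h u_inv f_inv cong density_u_divide le)
qed

lemma ratio_eq_quotients:
  assumes "0 < u x" "u x < \<infinity>"
  shows "average_ratio p s x = (q x / u x) / (p 0 x / u x)"
  using assms divide_mult_eq[of "inverse (u x)" "q x" "p 0 x"]
  by (simp add: average_ratio_eq divide_ennreal_def ennreal_inverse_eq_top_iff)

lemma AE_ratio_invariant_u:
  assumes g: "g \<in> G"
  shows "AE x in density M u. average_ratio p s (g x) = average_ratio p s x"
proof -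
  note [measurable] = G_measurable[OF g]
  have u_inv: "distr (density M u) M g = density M u"
    by (rule distr_density_eqI) (auto simp: emeasure_u emeasure_p0_vimage emeasure_q_vimage g)
  \<comment> \<open>Cancelling \<open>u\<close> at \<open>g x\<close> needs the bounds there as
    well; they transfer because \<open>g\<close> preserves \<open>density M u\<close>.\<close>
  have "AE x in distr (density M u) M g. 0 < u x \<and> u x < \<infinity>"
    unfolding u_inv by (rule AE_u_bounds)
  then have "AE x in density M u. 0 < u (g x) \<and> u (g x) < \<infinity>"
    by (subst (asm) AE_distr_iff) auto
  moreover have "AE x in density M u. q (g x) / u (g x) = q x / u x"
    by (rule AE_quotient_invariant[OF g]) (auto simp: u_def emeasure_q_vimage)
  moreover have "AE x in density M u. p 0 (g x) / u (g x) = p 0 x / u x"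
    by (rule AE_quotient_invariant[OF g]) (auto simp: u_def emeasure_p0_vimage)
  ultimately show ?thesis
    using AE_u_bounds by eventually_elim (simp add: ratio_eq_quotients)
qed

text \<open>Each law is absolutely continuous with respect to \<open>density M u\<close>: one
  positive alternative density already makes the average positive.\<close>

lemma AE_law_if_AE_u:
  assumes "AE x in density M u. P x" and i: "i \<le> s"
  shows "AE x in law M p i. P x"
proof -
  have "0 < u x" if "0 < p i x" for x
  proof (cases "i = 0")
    case False
    then have "i \<in> {1..s}" using i by auto
    moreover have "0 < p i x / of_nat s"
      using that by (simp add: ennreal_zero_less_divide of_nat_less_top)
    ultimately have "0 < q x"
      unfolding q_def by (intro sum_pos2[of _ i]) auto
    then show ?thesis by (simp add: u_def add_nonneg_pos)
  qed (use that in \<open>simp add: u_def add_pos_nonneg\<close>)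
  then show ?thesis
    using assms measurable_p by (auto simp: AE_density)
qed

section \<open>Almost invariance of the ratio regions and equality of powers\<close>

lemma ratio_test_cases:
  assumes "R \<in> ratio_tests M p s"
  obtains P where "\<And>x. x \<in> space M \<Longrightarrow> x \<in> R \<longleftrightarrow> P (average_ratio p s x)"
  using assms that unfolding ratio_tests_def by blast

lemma ratio_test_sets: "R \<in> ratio_tests M p s \<Longrightarrow> R \<in> sets M"
  unfolding ratio_tests_def by (auto intro!: sets.sets_Collect)

text \<open>Whatever the threshold and the inequality, membership depends on the point only through
  the ratio, which is invariant almost everywhere.\<close>

lemma ratio_test_almost_invariant:
  assumes R: "R \<in> ratio_tests M p s"
  shows "R \<in> almost_invariant_tests M p s G"
proof -
  obtain P where P: "\<And>x. x \<in> space M \<Longrightarrow> x \<in> R \<longleftrightarrow> P (average_ratio p s x)"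
    using ratio_test_cases[OF R] by metis
  have "AE x in law M p i. x \<in> R \<longleftrightarrow> g x \<in> R" if "g \<in> G" "i \<le> s" for g i
    using AE_law_if_AE_u[OF AE_ratio_invariant_u[OF that(1)] that(2)] AE_space[of "law M p i"]
    by eventually_elim (simp add: P G_space that)
  then show ?thesis
    using ratio_test_sets[OF R] by (simp add: almost_invariant_tests_def)
qed

text \<open>Transitivity supplies \<open>g\<close> carrying \<open>p i\<close> to
  \<open>p j\<close>. Under law \<open>i\<close>, almost invariance identifies \<open>S\<close> with
  its preimage under \<open>g\<close>, whose probability is that of \<open>S\<close> under law
  \<open>j\<close>.\<close>

lemma almost_invariant_power_eq:
  assumes S: "S \<in> almost_invariant_tests M p s G" and i: "i \<in> {1..s}" and j: "j \<in> {1..s}"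
  shows "emeasure (law M p i) S = emeasure (law M p j) S"
proof -
  have [measurable]: "S \<in> sets M"
    using S by (simp add: almost_invariant_tests_def)
  obtain g where g: "g \<in> G" and c: "carries_density M g (p i) (p j)"
    using transitive[OF i j] i
    by (auto simp: induced_permutations_def induces_permutation_def)
  note [measurable] = G_measurable[OF g]
  have "AE x in law M p i. x \<in> S \<longleftrightarrow> g x \<in> S"
    using S g i by (simp add: almost_invariant_tests_def)
  then have "AE x in law M p i. x \<in> S \<longleftrightarrow> x \<in> g -` S \<inter> space M"
    using AE_space[of "law M p i"] by eventually_elim auto
  then have "emeasure (law M p i) S = emeasure (law M p i) (g -` S \<inter> space M)"
    by (intro emeasure_eq_AE) auto
  then show ?thesis
    using carries_emeasure[OF c] by simp
qed

lemma almost_invariant_power_average: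
  assumes S: "S \<in> almost_invariant_tests M p s G" and i: "i \<in> {1..s}"
  shows "measure (law M p i) S = measure (density M q) S"
proof -
  have "S \<in> sets M"
    using S by (simp add: almost_invariant_tests_def)
  then show ?thesis
    using emeasure_q_eq[of S] almost_invariant_power_eq[OF S _ i] by (simp add: measure_def)
qed

section \<open>Ratio regions are most powerful\<close>

lemma AE_p0_q_finite: "AE x in M. p 0 x < \<infinity> \<and> q x < \<infinity>"
  using AE_u_finite by (auto simp: u_def)

text \<open>On a region that is null under the hypothesis, \<open>p 0\<close> vanishes almost
  everywhere; where \<open>q\<close> is positive the ratio is then infinite. So \<open>S\<close>
  lies in \<open>R\<close> up to a null set of \<open>density M q\<close>.\<close>

lemma null_ratio_test_most_powerful:
  assumes [measurable]: "S \<in> sets M" and null: "measure (law M p 0) S \<le> 0"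
    and R: "R = {x \<in> space M. \<infinity> \<le> average_ratio p s x}"
  shows "measure (density M q) S \<le> measure (density M q) R"
proof -
  interpret p0: prob_space "law M p 0" by (rule prob_law) simp
  interpret q: prob_space "density M q" by (rule prob_q)
  have [measurable]: "R \<in> sets M" unfolding R by measurable
  have "S \<in> null_sets (law M p 0)"
    using null by (auto simp: null_sets_def p0.emeasure_eq_measure measure_le_0_iff)
  then have "AE x in M. x \<in> S \<longrightarrow> p 0 x = 0"
    by (simp add: null_sets_density_iff)
  then have "AE x in density M q. x \<in> S \<longrightarrow> x \<in> R"
    unfolding AE_density[OF measurable_q] using AE_space
    by eventually_elim (auto simp: R average_ratio_eq)
  then show ?thesis
    by (intro q.finite_measure_mono_AE) auto
qed

text \<open>A finite threshold supplies the constant for the Neyman-Pearson lemma. The threshold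
  \<infinity> comes only with the weak inequality; that region has size 0, which is the case treated
  separately.\<close>

lemma ratio_test_most_powerful:
  assumes R: "R \<in> ratio_tests M p s" and S[measurable]: "S \<in> sets M"
    and level: "measure (law M p 0) S \<le> measure (law M p 0) R"
  shows "measure (density M q) S \<le> measure (density M q) R"
proof -
  have [measurable]: "R \<in> sets M" by (rule ratio_test_sets[OF R])
  obtain k where
    k: "R = {x \<in> space M. k \<le> average_ratio p s x} \<or>
      k < \<infinity> \<and> R = {x \<in> space M. k < average_ratio p s x}"
    using R unfolding ratio_tests_def by blast
  show ?thesis
  proof (cases "k < \<infinity>")
    case True
    have "AE x in M. x \<in> R \<longrightarrow> k * p 0 x \<le> q x"
      using AE_p0_q_finite
      by eventually_elim (use k True ennreal_divide_bound(1) in \<open>auto simp: average_ratio_eq\<close>)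
    moreover have "AE x in M. x \<notin> R \<longrightarrow> q x \<le> k * p 0 x"
      using AE_p0_q_finite AE_space
      by eventually_elim (use k True ennreal_divide_bound(2) in \<open>auto simp: average_ratio_eq not_le not_less\<close>)
    ultimately show ?thesis
      using True level prob_space.finite_measure[OF prob_law] prob_space.finite_measure[OF prob_q]
      by (intro Neyman_Pearson[of "p 0" M q R S k]) auto
  next
    case False
    then have R_top: "R = {x \<in> space M. \<infinity> \<le> average_ratio p s x}"
      using k by (auto simp: not_less top_unique)
    interpret p0: prob_space "law M p 0" by (rule prob_law) simp
    \<comment> \<open>The ratio is finite wherever \<open>p 0\<close> is positive and
      \<open>q\<close> is finite.\<close>
    have "AE x in law M p 0. x \<notin> R"
      unfolding AE_density[OF measurable_p0] using AE_p0_q_finite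
      by eventually_elim (auto simp: R_top average_ratio_eq top_unique ennreal_divide_eq_top_iff)
    then have "measure (law M p 0) R = 0"
      by (subst p0.prob_eq_0) auto
    then show ?thesis
      using null_ratio_test_most_powerful[OF S _ R_top] level by simp
  qed
qed

text \<open>For almost invariant regions the power against any alternative equals that against the
  average, so all \<open>s\<close> comparisons reduce to a single simple alternative.\<close>

lemma ratio_test_UMP_almost_invariant:
  assumes R: "R \<in> ratio_tests M p s"
  shows "UMP_among (almost_invariant_tests M p s G) M p s (measure (law M p 0) R) R"
  unfolding UMP_among_def
proof (intro conjI ballI impI)
  fix S i
  assume S: "S \<in> almost_invariant_tests M p s G" and i: "i \<in> {1..s}"
    and "measure (law M p 0) S \<le> measure (law M p 0) R"
  moreover from S have "S \<in> sets M"
    by (simp add: almost_invariant_tests_def)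
  ultimately show "measure (law M p i) S \<le> measure (law M p i) R"
    using ratio_test_most_powerful[OF R] ratio_test_almost_invariant[OF R]
    by (simp add: almost_invariant_power_average)
qed (use ratio_test_almost_invariant[OF R] in auto)

section \<open>Strictly invariant versions\<close>

lemma invariant_imp_almost_invariant:
  "S \<in> invariant_tests M G \<Longrightarrow> S \<in> almost_invariant_tests M p s G"
  by (auto simp: invariant_tests_def almost_invariant_tests_def intro!: AE_I2)

lemma equivalent_measure_eq:
  assumes "equivalent_tests M p s R' R" "R' \<in> sets M" "R \<in> sets M" "i \<le> s"
  shows "measure (law M p i) R' = measure (law M p i) R"
  using assms by (intro measure_eq_AE) (auto simp: equivalent_tests_def)

text \<open>Equivalent regions have the same size and powers, and optimality among almost invariant
  regions passes to the smaller class of invariant ones.\<close>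

lemma UMP_invariant_if_equivalent:
  assumes R: "R \<in> ratio_tests M p s" and R': "R' \<in> invariant_tests M G"
    and eq: "equivalent_tests M p s R' R"
  shows "UMP_invariant M G p s (measure (law M p 0) R) R'"
proof -
  have "R' \<in> sets M"
    using R' by (simp add: invariant_tests_def)
  then show ?thesis
    using ratio_test_UMP_almost_invariant[OF R] R' invariant_imp_almost_invariant
      equivalent_measure_eq[OF eq _ ratio_test_sets[OF R]]
    by (auto simp: UMP_among_def)
qed

text \<open>Countability serves twice: it makes a set defined by all transformations measurable, and
  it lets their exceptional null sets be united into one.\<close>

lemma countable_invariant_version:
  assumes R: "R \<in> almost_invariant_tests M p s G" and "countable G"
  shows "\<exists>R'\<in>invariant_tests M G. equivalent_tests M p s R' R"
proof
  \<comment> \<open>The points whose whole orbit lies in \<open>R\<close>, that is, the largest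
    invariant subset of \<open>R\<close>.\<close>
  let ?R = "{x \<in> space M. \<forall>h\<in>G. h x \<in> R}"
  have [measurable]: "R \<in> sets M"
    using R by (simp add: almost_invariant_tests_def)
  have "?R = space M \<inter> (\<Inter>h\<in>G. h -` R \<inter> space M)"
    using G_id by auto
  also have "\<dots> \<in> sets M"
    using \<open>countable G\<close> G_id
    by (intro sets.Int sets.top sets.countable_INT') (auto intro: measurable_sets G_measurable)
  finally have "?R \<in> sets M" .
  moreover have "x \<in> ?R \<longleftrightarrow> g x \<in> ?R" if g: "g \<in> G" and x: "x \<in> space M" for g x
  proof
    assume "x \<in> ?R"
    then show "g x \<in> ?R"
      using G_compose[OF g] x G_space[OF g] by fastforce
  next
    assume gx: "g x \<in> ?R"
    obtain k where k: "k \<in> G" "\<And>x. x \<in> space M \<Longrightarrow> k (g x) = x"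
      using G_inverse[OF g] by auto
    show "x \<in> ?R"
    proof (clarify, intro conjI ballI x)
      \<comment> \<open>As \<open>k\<close> undoes \<open>g\<close>, the point
        \<open>h x = h (k (g x))\<close> lies on the orbit of \<open>g x\<close>.\<close>
      fix h assume "h \<in> G"
      then obtain l where "l \<in> G" "\<And>y. y \<in> space M \<Longrightarrow> l y = h (k y)"
        using G_compose[OF k(1)] by blast
      then show "h x \<in> R"
        using gx k x by force
    qed
  qed
  ultimately show "?R \<in> invariant_tests M G"
    by (simp add: invariant_tests_def)
  have "AE x in law M p i. x \<in> ?R \<longleftrightarrow> x \<in> R" if "i \<le> s" for i
  proof -
    have "AE x in law M p i. \<forall>h\<in>G. x \<in> R \<longleftrightarrow> h x \<in> R"
      using R that \<open>countable G\<close> by (simp add: AE_ball_countable almost_invariant_tests_def)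
    then show ?thesis
      using AE_space[of "law M p i"] by eventually_elim (use G_id in auto)
  qed
  then show "equivalent_tests M p s ?R R"
    by (simp add: equivalent_tests_def)
qed

text \<open>The permutation only reorders the sum, so numerator and denominator both change by the
  same factor \<open>J x\<close>, which cancels because it is positive and finite.\<close>

lemma ratio_invariant_if_pointwise:
  assumes "pointwise_transformation M p s g" and x: "x \<in> space M"
  shows "average_ratio p s (g x) = average_ratio p s x"
proof -
  obtain J \<pi> where \<pi>: "\<pi> permutes {1..s}" and J: "0 < J x" "J x < \<infinity>"
    and p0: "p 0 (g x) * J x = p 0 x"
    and pi: "\<And>i. i \<in> {1..s} \<Longrightarrow> p (\<pi> i) (g x) * J x = p i x"
    using assms unfolding pointwise_transformation_def by blast
  have "q (g x) * J x = (\<Sum>i=1..s. p (\<pi> i) (g x) / of_nat s) * J x"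
    using sum.permute[OF \<pi>, of "\<lambda>i. p i (g x) / of_nat s"] by (simp add: q_def o_def)
  also have "\<dots> = q x"
    by (simp add: q_def sum_distrib_left sum_distrib_right pi[symmetric] divide_ennreal_def mult_ac)
  finally show ?thesis
    using divide_mult_eq[of "J x" "q (g x)" "p 0 (g x)"] J p0 by (simp add: average_ratio_eq)
qed

lemma ratio_test_invariant_if_pointwise:
  assumes R: "R \<in> ratio_tests M p s" and "\<forall>g\<in>G. pointwise_transformation M p s g"
  shows "R \<in> invariant_tests M G"
proof -
  obtain P where P: "\<And>x. x \<in> space M \<Longrightarrow> x \<in> R \<longleftrightarrow> P (average_ratio p s x)"
    using ratio_test_cases[OF R] by metis
  then show ?thesis
    using assms(2) ratio_test_sets[OF R]
    by (simp add: invariant_tests_def ratio_invariant_if_pointwise G_space)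
qed

end

text \<open>Ratio regions are in general invariant only almost everywhere, so strict invariance is
  reached through equivalent regions or a pointwise formula. The level is the size of the region
  itself, since without randomization a prescribed level need not be attained.\<close>

theorem theorem3p1:
  fixes M :: "'a measure" and p :: "nat \<Rightarrow> 'a \<Rightarrow> ennreal" and s :: nat and G :: "('a \<Rightarrow> 'a) set"
  assumes "1 \<le> s"
    and "\<And>i. i \<le> s \<Longrightarrow> p i \<in> borel_measurable M"
    and "\<And>i. i \<le> s \<Longrightarrow> prob_space (law M p i)"
    and "transformation_group M G"
    and "\<And>g. g \<in> G \<Longrightarrow> carries_density M g (p 0) (p 0)"
    and "\<And>g. g \<in> G \<Longrightarrow> \<exists>\<pi>. induces_permutation M p s g \<pi>"
    and "\<And>i j. i \<in> {1..s} \<Longrightarrow> j \<in> {1..s} \<Longrightarrow> \<exists>\<pi>\<in>induced_permutations M p s G. \<pi> i = j"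
  shows "\<forall>R\<in>ratio_tests M p s. \<forall>\<alpha>. measure (law M p 0) R = \<alpha> \<longrightarrow>
      UMP_among (almost_invariant_tests M p s G) M p s \<alpha> R \<and>
      (\<forall>R'\<in>invariant_tests M G. equivalent_tests M p s R' R \<longrightarrow> UMP_invariant M G p s \<alpha> R') \<and>
      (countable G \<longrightarrow> (\<exists>R'. equivalent_tests M p s R' R \<and> UMP_invariant M G p s \<alpha> R')) \<and>
      ((\<forall>g\<in>G. pointwise_transformation M p s g) \<longrightarrow> UMP_invariant M G p s \<alpha> R)"
proof -
  interpret transitive_testing_problem M p s G
    using assms by (rule transitive_testing_problem.intro)
  have "equivalent_tests M p s R R" for R
    by (simp add: equivalent_tests_def)
  then show ?thesis
    using ratio_test_UMP_almost_invariant UMP_invariant_if_equivalent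
      countable_invariant_version[OF ratio_test_almost_invariant]
      ratio_test_invariant_if_pointwise
    by metis
qed

end
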